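(* Let $A$ be the incidence matrix of the graph $G$ and let $\rho>0$. For every diagonal matrix $\Theta\in\mathbb R^{n\times n}$ with positive diagonal entries, the matrix $A(\Theta^{-1}+\rho I)^{-1}A^T$ is the Laplacian of a weighted undirected graph, and hence $$A(\Theta^{-1}+\rho I)^{-1}A^T=\mathcal D_\Theta-\mathcal A_\Theta,$$ where $\mathcal D_\Theta$ and $\mathcal A_\Theta$ are the degree and adjacency matrices of the weighted graph $G_\Theta$.
   Context: $G=(V,E)$ is a connected graph without self-loops with directed edges $E\subset V\times V$, $|V|=m$, $|E|=n$. Its incidence matrix $A\in\{-1,0,1\}^{m\times n}$ is $A_{ve}=-1$ if $e=(v,w)$ for some $w\in V$, $A_{ve}=1$ if $e=(w,v)$ for some $w\in V$, $A_{ve}=0$ otherwise. $G_\Theta$ is the weighted undirected graph with the same connectivity as $G$ in which edge $e$ has weight $\frac{\Theta_{ee}}{1+\rho\Theta_{ee}}$ (equivalently, the column of the incidence matrix for edge $e$ is scaled by $\sqrt{\Theta_{ee}/(1+\rho\Theta_{ee})}$, giving $A_\Theta=A(\Theta^{-1}+\rho I)^{-1/2}$). Its adjacency matrix $\mathcal A_\Theta\in\mathbb R^{m\times m}$ is symmetric with zero diagonal and, for $v\ne w$, $(\mathcal A_\Theta)_{vw}$ is the sum of the weights of the edges of $E$ joining $v$ and $w$ (in either direction). Its degree matrix $\mathcal D_\Theta$ is diagonal with $(\mathcal D_\Theta)_{vv}=\sum_w(\mathcal A_\Theta)_{vw}$. The Laplacian of a weighted graph is its degree matrix minus its adjacency matrix.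 *)

theory Defs
  imports
    "Graph_Theory.Digraph_Component"
    "Jordan_Normal_Form.Gauss_Jordan_Elimination"
begin

text \<open>
  The directed graph $G = (V, E)$ with $E \subseteq V \times V$ is a \<^typ>\<open>'v pair_pre_digraph\<close>.
  Matrices have numerical indices, so $V$ and $E$ are enumerated by duplicate-free lists
  \<open>vs\<close> and \<open>es\<close>: row or column \<open>i\<close> belongs to \<open>vs ! i\<close> or \<open>es ! i\<close>.
\<close>

definition incidence_matrix :: "'v list \<Rightarrow> ('v \<times> 'v) list \<Rightarrow> real mat" where
  "incidence_matrix vs es = mat (length vs) (length es) (\<lambda>(i, j).
     if \<exists>w. es ! j = (vs ! i, w) then -1
     else if \<exists>w. es ! j = (w, vs ! i) then 1
     else 0)"

text \<open>
  The result is the two-sided inverse for invertible matrices and unspecified for all others.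
\<close>

definition matrix_inverse :: "real mat \<Rightarrow> real mat" where
  "matrix_inverse M = the (mat_inverse M)"

text \<open>
  Weighted undirected graphs are loop-free, and their edges have names, so that parallel edges
  are possible: a directed graph may contain both $(v,w)$ and $(w,v)$, which become two
  edges between $v$ and $w$ with separate weights.
\<close>

record ('v, 'e) wgraph =
  wverts :: "'v set"
  wedges :: "'e set"
  wends :: "'e \<Rightarrow> 'v set"
  weight :: "'e \<Rightarrow> real"

locale weighted_undirected_graph =
  fixes H :: "('v, 'e) wgraph"
  assumes finite_wverts: "finite (wverts H)"
    and finite_wedges: "finite (wedges H)"
    and wends_subset: "e \<in> wedges H \<Longrightarrow> wends H e \<subseteq> wverts H"
    and card_wends: "e \<in> wedges H \<Longrightarrow> card (wends H e) = 2"
    and weight_pos: "e \<in> wedges H \<Longrightarrow> weight H e > 0"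

definition adjacency :: "('v, 'e) wgraph \<Rightarrow> 'v \<Rightarrow> 'v \<Rightarrow> real" where
  "adjacency H v w =
     (if v = w then 0 else (\<Sum>e \<in> {e \<in> wedges H. wends H e = {v, w}}. weight H e))"

definition adjacency_matrix :: "'v list \<Rightarrow> ('v, 'e) wgraph \<Rightarrow> real mat" where
  "adjacency_matrix vs H =
     mat (length vs) (length vs) (\<lambda>(i, j). adjacency H (vs ! i) (vs ! j))"

definition degree_matrix :: "'v list \<Rightarrow> ('v, 'e) wgraph \<Rightarrow> real mat" where
  "degree_matrix vs H =
     mat (length vs) (length vs)
       (\<lambda>(i, j). if i = j then (\<Sum>w \<in> wverts H. adjacency H (vs ! i) w) else 0)"

definition laplacian_matrix :: "'v list \<Rightarrow> ('v, 'e) wgraph \<Rightarrow> real mat" where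
  "laplacian_matrix vs H = degree_matrix vs H - adjacency_matrix vs H"

text \<open>
  $G_\Theta$. Its edges are named by their positions in \<open>es\<close>, the indices of $\Theta$.
\<close>

definition theta_graph ::
  "'v pair_pre_digraph \<Rightarrow> ('v \<times> 'v) list \<Rightarrow> real \<Rightarrow> real mat \<Rightarrow> ('v, nat) wgraph" where
  "theta_graph G es \<rho> \<Theta> =
     \<lparr> wverts = pverts G,
       wedges = {..<length es},
       wends = (\<lambda>k. {fst (es ! k), snd (es ! k)}),
       weight = (\<lambda>k. \<Theta> $$ (k, k) / (1 + \<rho> * \<Theta> $$ (k, k))) \<rparr>"

end

theory Submission
  imports Defs
begin

text \<open>
  The inverse of a diagonal matrix is taken entrywise, so $W = (\Theta^{-1} + \rho I)^{-1}$ is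
  diagonal with entries $(\Theta_{kk}^{-1} + \rho)^{-1} = \Theta_{kk}/(1 + \rho\Theta_{kk}) > 0$,
  the edge weights of $G_\Theta$ (\<open>matrix_inverse_diag\<close> is used twice). Therefore the
  $(i,j)$ entry of $A W A^T$ is $\sum_k w_k A_{ik} A_{jk}$.

  Every edge has two distinct ends, so a column of $A$ has exactly two nonzero entries, $-1$ and
  $1$. For $i \ne j$ the product $A_{ik} A_{jk}$ is $-1$ if edge $k$ joins the vertices $i$
  and $j$, and $0$ otherwise, which gives minus the adjacency. For $i = j$ the product is $1$
  if vertex $i$ is an end of edge $k$, and $0$ otherwise, which gives the total weight at
  vertex $i$. That total is the degree, because every edge at $i$ is counted in the adjacency
  of $i$ with exactly one other vertex (\<open>sum_adjacency\<close>).
\<close>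

lemma matrix_inverse_eqI:
  assumes D: "D \<in> carrier_mat n n" and E: "E \<in> carrier_mat n n"
    and DE: "D * E = 1\<^sub>m n" and ED: "E * D = 1\<^sub>m n"
  shows "matrix_inverse D = E"
proof (cases "mat_inverse D")
  case None
  have "D \<in> Units (ring_mat TYPE(real) n ())"
    using assms unfolding Units_def ring_mat_def by auto
  then show ?thesis using mat_inverse(1)[OF D None, of "()"] by simp
next
  case (Some B)
  have B: "B * D = 1\<^sub>m n" "B \<in> carrier_mat n n"
    using mat_inverse(2)[OF D Some] by auto
  have "B = B * (D * E)" using B by (simp add: DE)
  also have "\<dots> = B * D * E" using B D E by (intro assoc_mult_mat[symmetric])
  also have "\<dots> = E" using E by (simp add: B)
  finally show ?thesis by (simp add: matrix_inverse_def Some)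
qed

text \<open>The diagonal matrix with entries \<open>d 0, \<dots>, d (n - 1)\<close>.\<close>

definition diag :: "nat \<Rightarrow> (nat \<Rightarrow> real) \<Rightarrow> real mat" where
  "diag n d = mat n n (\<lambda>(i, j). if i = j then d i else 0)"

lemma diag_carrier [simp]: "diag n d \<in> carrier_mat n n"
  by (simp add: diag_def)

lemma diagonal_mat_eq_diag:
  assumes "D \<in> carrier_mat n n" and "diagonal_mat D"
  shows "D = diag n (\<lambda>k. D $$ (k, k))"
  using assms by (intro eq_matI) (auto simp: diag_def diagonal_mat_def)

lemma mult_diag_index:
  assumes "A \<in> carrier_mat m n" and "i < m" and "k < n"
  shows "(A * diag n d) $$ (i, k) = A $$ (i, k) * d k"
proof -
  have "(A * diag n d) $$ (i, k) = (\<Sum>l\<in>{0..<n}. A $$ (i, l) * (if l = k then d l else 0))"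
    using assms by (simp add: diag_def scalar_prod_def)
  also have "\<dots> = (\<Sum>l\<in>{0..<n}. if l = k then A $$ (i, l) * d l else 0)"
    by (rule sum.cong) auto
  also have "\<dots> = A $$ (i, k) * d k" using assms by simp
  finally show ?thesis .
qed

lemma diag_mult_diag: "diag n d * diag n e = diag n (\<lambda>k. d k * e k)"
proof (rule eq_matI)
  fix i j assume "i < dim_row (diag n (\<lambda>k. d k * e k))" "j < dim_col (diag n (\<lambda>k. d k * e k))"
  then have "i < n" "j < n" by (simp_all add: diag_def)
  then show "(diag n d * diag n e) $$ (i, j) = diag n (\<lambda>k. d k * e k) $$ (i, j)"
    by (subst mult_diag_index[OF diag_carrier]) (simp_all add: diag_def)
qed (simp_all add: diag_def)

lemma matrix_inverse_diag:
  assumes "\<And>k. k < n \<Longrightarrow> d k \<noteq> 0"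
  shows "matrix_inverse (diag n d) = diag n (\<lambda>k. inverse (d k))"
proof (rule matrix_inverse_eqI)
  show "diag n d * diag n (\<lambda>k. inverse (d k)) = 1\<^sub>m n"
    unfolding diag_mult_diag using assms by (intro eq_matI) (auto simp: diag_def)
  show "diag n (\<lambda>k. inverse (d k)) * diag n d = 1\<^sub>m n"
    unfolding diag_mult_diag using assms by (intro eq_matI) (auto simp: diag_def)
qed simp_all

lemma mult_diag_mult_transpose_index:
  assumes A: "A \<in> carrier_mat m n" and "i < m" and "j < m"
  shows "(A * diag n d * transpose_mat A) $$ (i, j) = (\<Sum>k<n. d k * (A $$ (i, k) * A $$ (j, k)))"
proof -
  have mult_transpose: "(B * transpose_mat A) $$ (i, j) = (\<Sum>k\<in>{0..<n}. B $$ (i, k) * A $$ (j, k))"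
    if "B \<in> carrier_mat m n" for B
    using that assms by (simp add: scalar_prod_def)
  have "(A * diag n d * transpose_mat A) $$ (i, j) =
      (\<Sum>k\<in>{0..<n}. (A * diag n d) $$ (i, k) * A $$ (j, k))"
    by (rule mult_transpose[OF mult_carrier_mat[OF A diag_carrier]])
  also have "\<dots> = (\<Sum>k<n. d k * (A $$ (i, k) * A $$ (j, k)))"
    using assms by (intro sum.cong) (auto simp: mult_diag_index simp del: index_mult_mat)
  finally show ?thesis .
qed

text \<open>The degree of a vertex is the total weight of the edges that end in it.\<close>

lemma (in weighted_undirected_graph) sum_adjacency:
  "(\<Sum>w \<in> wverts H. adjacency H v w) = (\<Sum>e \<in> {e \<in> wedges H. v \<in> wends H e}. weight H e)"
proof -
  let ?E = "\<lambda>w. {e \<in> wedges H. wends H e = {v, w}}"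
  have ends: "\<exists>w \<in> wverts H - {v}. wends H e = {v, w}" if "e \<in> wedges H" "v \<in> wends H e" for e
    using card_wends[OF that(1)] wends_subset[OF that(1)] that(2)
    by (auto simp: card_2_iff doubleton_eq_iff)
  have "(\<Sum>w \<in> wverts H. adjacency H v w) = (\<Sum>w \<in> wverts H - {v}. adjacency H v w)"
    using finite_wverts by (intro sum.mono_neutral_right) (auto simp: adjacency_def)
  also have "\<dots> = (\<Sum>w \<in> wverts H - {v}. sum (weight H) (?E w))"
    by (rule sum.cong) (auto simp: adjacency_def)
  also have "\<dots> = sum (weight H) (\<Union>w \<in> wverts H - {v}. ?E w)"
    using finite_wverts finite_wedges
    by (intro sum.UNION_disjoint[symmetric]) (auto simp: doubleton_eq_iff)
  also have "(\<Union>w \<in> wverts H - {v}. ?E w) = {e \<in> wedges H. v \<in> wends H e}"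
    using ends by fast
  finally show ?thesis .
qed

lemma incidence_matrix_carrier: "incidence_matrix vs es \<in> carrier_mat (length vs) (length es)"
  by (simp add: incidence_matrix_def)

lemma incidence_matrix_index:
  assumes "i < length vs" and "k < length es"
  shows "incidence_matrix vs es $$ (i, k) =
    (if vs ! i = fst (es ! k) then -1 else if vs ! i = snd (es ! k) then 1 else 0)"
  using assms by (cases "es ! k") (auto simp: incidence_matrix_def)

text \<open>
  The list \<open>vs\<close> need not contain all vertices, since each entry is compared separately and
  degrees are sums over all of \<open>wverts H\<close>. The orientation of the edges drops out because
  the entries of the incidence matrix enter only in products within one column.
\<close>

lemma incidence_mult_diag_mult_transpose:
  assumes H: "weighted_undirected_graph H" and vs: "distinct vs"
    and edges: "wedges H = {..<length es}"
    and ends: "\<And>k. k < length es \<Longrightarrow> wends H k = {fst (es ! k), snd (es ! k)}"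
  shows "incidence_matrix vs es * diag (length es) (weight H) * transpose_mat (incidence_matrix vs es)
    = laplacian_matrix vs H"
    (is "?A * ?D * _ = _")
proof (rule eq_matI)
  interpret weighted_undirected_graph H by (rule H)
  let ?n = "length es"
  have loopfree: "fst (es ! k) \<noteq> snd (es ! k)" if "k < ?n" for k
    using card_wends[of k] that by (auto simp: edges ends)
  fix i j assume "i < dim_row (laplacian_matrix vs H)" "j < dim_col (laplacian_matrix vs H)"
  then have ij: "i < length vs" "j < length vs"
    by (simp_all add: laplacian_matrix_def adjacency_matrix_def)
  have entry: "(?A * ?D * transpose_mat ?A) $$ (i, j) =
      (\<Sum>k<?n. weight H k * (?A $$ (i, k) * ?A $$ (j, k)))"
    using incidence_matrix_carrier ij by (rule mult_diag_mult_transpose_index)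
  show "(?A * ?D * transpose_mat ?A) $$ (i, j) = laplacian_matrix vs H $$ (i, j)"
  proof (cases "i = j")
    case True
    have "(\<Sum>k<?n. weight H k * (?A $$ (i, k) * ?A $$ (j, k))) =
        (\<Sum>k<?n. if vs ! i \<in> wends H k then weight H k else 0)"
      using ij True by (intro sum.cong) (auto simp: incidence_matrix_index ends)
    also have "\<dots> = (\<Sum>w \<in> wverts H. adjacency H (vs ! i) w)"
      unfolding sum_adjacency edges by (rule sum.inter_filter[symmetric]) simp
    finally show ?thesis using entry ij True
      by (simp add: laplacian_matrix_def degree_matrix_def adjacency_matrix_def adjacency_def)
  next
    case False
    then have ne: "vs ! i \<noteq> vs ! j" using vs ij by (simp add: nth_eq_iff_index_eq)
    have "(\<Sum>k<?n. weight H k * (?A $$ (i, k) * ?A $$ (j, k))) =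
        (\<Sum>k<?n. - (if wends H k = {vs ! i, vs ! j} then weight H k else 0))"
      using ij ne loopfree
      by (intro sum.cong) (auto simp: incidence_matrix_index ends doubleton_eq_iff)
    also have "\<dots> = - adjacency H (vs ! i) (vs ! j)"
      using ne by (simp add: adjacency_def edges sum_negf flip: sum.inter_filter)
    finally show ?thesis using entry ij False
      by (simp add: laplacian_matrix_def degree_matrix_def adjacency_matrix_def)
  qed
qed (simp_all add: incidence_matrix_def laplacian_matrix_def adjacency_matrix_def)

lemma weighted_undirected_theta_graph:
  assumes "pair_digraph G" and "set es = parcs G" and "\<rho> > 0"
    and pos: "\<And>k. k < length es \<Longrightarrow> \<Theta> $$ (k, k) > 0"
  shows "weighted_undirected_graph (theta_graph G es \<rho> \<Theta>)"
proof -
  interpret pair_digraph G by fact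
  have arc: "es ! k \<in> parcs G" if "k < length es" for k
    using that assms(2) nth_mem by blast
  show ?thesis
  proof
    fix k assume "k \<in> wedges (theta_graph G es \<rho> \<Theta>)"
    then have k: "k < length es" by (simp add: theta_graph_def)
    show "wends (theta_graph G es \<rho> \<Theta>) k \<subseteq> wverts (theta_graph G es \<rho> \<Theta>)"
      using arc[OF k] by (simp add: theta_graph_def arc_fst_in_verts arc_snd_in_verts)
    show "card (wends (theta_graph G es \<rho> \<Theta>) k) = 2"
      using pair_no_loops[OF arc[OF k]] by (simp add: theta_graph_def)
    show "weight (theta_graph G es \<rho> \<Theta>) k > 0"
      using pos[OF k] \<open>\<rho> > 0\<close> by (simp add: theta_graph_def add_pos_pos)
  qed (simp_all add: theta_graph_def pair_finite_verts)
qed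

text \<open>The matrix $(\Theta^{-1} + \rho I)^{-1}$ carries the edge weights of $G_\Theta$.\<close>

lemma theta_weight_matrix:
  assumes \<Theta>: "\<Theta> \<in> carrier_mat n n" "diagonal_mat \<Theta>"
    and pos: "\<And>k. k < n \<Longrightarrow> \<Theta> $$ (k, k) > 0" and "\<rho> > 0"
  shows "matrix_inverse (matrix_inverse \<Theta> + \<rho> \<cdot>\<^sub>m 1\<^sub>m n) = diag n (weight (theta_graph G es \<rho> \<Theta>))"
proof -
  let ?t = "\<lambda>k. \<Theta> $$ (k, k)"
  have "matrix_inverse \<Theta> = diag n (\<lambda>k. inverse (?t k))"
    using matrix_inverse_diag[of n ?t] pos diagonal_mat_eq_diag[OF \<Theta>] by fastforce
  then have "matrix_inverse \<Theta> + \<rho> \<cdot>\<^sub>m 1\<^sub>m n = diag n (\<lambda>k. inverse (?t k) + \<rho>)"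
    by (intro eq_matI) (auto simp: diag_def)
  moreover have "inverse (?t k) + \<rho> \<noteq> 0" if "k < n" for k
    using pos[OF that] \<open>\<rho> > 0\<close> by (smt (verit) positive_imp_inverse_positive)
  ultimately have "matrix_inverse (matrix_inverse \<Theta> + \<rho> \<cdot>\<^sub>m 1\<^sub>m n) =
      diag n (\<lambda>k. inverse (inverse (?t k) + \<rho>))"
    by (simp add: matrix_inverse_diag)
  moreover have "inverse (inverse (?t k) + \<rho>) = weight (theta_graph G es \<rho> \<Theta>) k" if "k < n" for k
  proof -
    have "inverse (?t k) + \<rho> = (1 + \<rho> * ?t k) / ?t k"
      using pos[OF that] by (simp add: field_simps)
    then show ?thesis by (simp add: theta_graph_def)
  qed
  ultimately show ?thesis by (auto simp: diag_def intro!: eq_matI)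
qed

theorem lemma2:
  fixes G :: "'v pair_pre_digraph"
    and vs :: "'v list" and es :: "('v \<times> 'v) list"
    and n :: nat and \<rho> :: real and \<Theta> :: "real mat"
  assumes "pair_digraph G" and "Digraph_Component.connected (with_proj G)"
    and "distinct vs" and "set vs = pverts G"
    and "distinct es" and "set es = parcs G"
    and "n = card (parcs G)"
    and "\<rho> > 0"
    and "\<Theta> \<in> carrier_mat n n" and "diagonal_mat \<Theta>" and "\<And>k. k < n \<Longrightarrow> \<Theta> $$ (k, k) > 0"
  defines "A \<equiv> incidence_matrix vs es"
  defines "M \<equiv> A * matrix_inverse (matrix_inverse \<Theta> + \<rho> \<cdot>\<^sub>m 1\<^sub>m n) * transpose_mat A"
  defines "G\<^sub>\<Theta> \<equiv> theta_graph G es \<rho> \<Theta>"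
  shows "(\<exists>H :: ('v, nat) wgraph. weighted_undirected_graph H \<and> wverts H = pverts G \<and>
            M = laplacian_matrix vs H) \<and>
         weighted_undirected_graph G\<^sub>\<Theta> \<and>
         M = degree_matrix vs G\<^sub>\<Theta> - adjacency_matrix vs G\<^sub>\<Theta>"
proof -
  have n: "n = length es"
    using \<open>n = card (parcs G)\<close> \<open>distinct es\<close> \<open>set es = parcs G\<close> distinct_card by metis
  have graph: "weighted_undirected_graph G\<^sub>\<Theta>"
    unfolding G\<^sub>\<Theta>_def using assms(1,6,8,11) n by (intro weighted_undirected_theta_graph) auto
  have "M = A * diag (length es) (weight G\<^sub>\<Theta>) * transpose_mat A"
    unfolding M_def G\<^sub>\<Theta>_def using theta_weight_matrix[OF assms(9,10,11,8), of G es] n by simp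
  also have "\<dots> = laplacian_matrix vs G\<^sub>\<Theta>"
    unfolding A_def using graph \<open>distinct vs\<close>
    by (rule incidence_mult_diag_mult_transpose) (simp_all add: G\<^sub>\<Theta>_def theta_graph_def)
  finally have M: "M = laplacian_matrix vs G\<^sub>\<Theta>" .
  have "wverts G\<^sub>\<Theta> = pverts G" by (simp add: G\<^sub>\<Theta>_def theta_graph_def)
  with graph M show ?thesis unfolding laplacian_matrix_def by blast
qed

end
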